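(* Let $G$ be a finite group with identity element $e$ and let $\mu:G\to\mathbb{Z}_{>0}$ be a function such that $\mu(e)=1$. If $H\leqslant G$, then $$\sum_{x\in H}\mu(x)\,\mathrm{occ}_G(x)=\sum_{L\leqslant G}\left(\sum_{x\in H\cap L}\mu(x)\right).$$
   Context: $H\leqslant G$ means that $H$ is a subgroup of $G$; the sum $\sum_{L\leqslant G}$ runs over all subgroups $L$ of $G$. For $x\in G$, the subgroup-occurrence of $x$ in $G$ is $\mathrm{occ}_G(x):=|\{H\leqslant G\mid x\in H\}|$, the number of subgroups of $G$ containing $x$. *)

theory Defs
  imports "HOL-Algebra.Coset"
begin

definition occ :: "('a, 'b) monoid_scheme \<Rightarrow> 'a \<Rightarrow> nat" where
  "occ G x = card {H. subgroup H G \<and> x \<in> H}"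

end

theory Submission
  imports Defs
begin

text \<open>Double counting: give each pair \<open>(x, L)\<close> with \<open>L\<close> a subgroup
  and \<open>x\<close> in \<open>H \<inter> L\<close> the weight \<open>\<mu> x\<close>. For fixed
  \<open>x\<close> the total is \<open>\<mu> x\<close> times the number of subgroups containing
  \<open>x\<close>; for fixed \<open>L\<close> it is the inner sum on the right. The exchange is
  \<open>sum.swap_restrict\<close>.\<close>

theorem theorem5p5:
  fixes G :: "('a, 'b) monoid_scheme" and \<mu> :: "'a \<Rightarrow> nat" and H :: "'a set"
  assumes "group G"
    and "finite (carrier G)"
    and "\<And>x. x \<in> carrier G \<Longrightarrow> \<mu> x > 0"
    and "\<mu> \<one>\<^bsub>G\<^esub> = 1"
    and "subgroup H G"
  shows "(\<Sum>x\<in>H. \<mu> x * occ G x) = (\<Sum>L | subgroup L G. \<Sum>x\<in>H \<inter> L. \<mu> x)"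
proof -
  \<comment> \<open>The exchange requires both index sets, the subgroups and \<open>H\<close>, to be
    finite.\<close>
  have "{L. subgroup L G} \<subseteq> Pow (carrier G)"
    by (auto dest: subgroup.subset)
  then have finL: "finite {L. subgroup L G}"
    using assms(2) by (simp add: finite_subset)
  have finH: "finite H"
    using assms(2) subgroup.subset[OF assms(5)] by (rule finite_subset[rotated])
  \<comment> \<open>As \<open>occ\<close> is a cardinality, the product unfolds into a sum of the
    constant \<open>\<mu> x\<close>, which exposes the relation \<open>x \<in> L\<close> for the
    swap.\<close>
  have "(\<Sum>x\<in>H. \<mu> x * occ G x) = (\<Sum>x\<in>H. \<Sum>L | subgroup L G \<and> x \<in> L. \<mu> x)"
    by (simp add: occ_def mult.commute)
  also have "\<dots> = (\<Sum>L | subgroup L G. \<Sum>x | x \<in> H \<and> x \<in> L. \<mu> x)"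
    using sum.swap_restrict[OF finH finL, of "\<lambda>x L. \<mu> x" "\<lambda>x L. x \<in> L"] by simp
  finally show ?thesis
    by (simp add: Int_def)
qed

end
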